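(* Let $m\ge2$ be an integer and let $\boldsymbol{\sigma}\in\hat\Sigma^{(m)}$ be a strict ranking pattern. Put $z_m:=17\cdot m\cdot m!$ and $\bar\theta_m:=\prod_{h=2}^{m}\left[h\cdot z_m^{h-1}-\frac{h(h-1)}{2}\right]$. For $(j_1,\ldots,j_m)\in\Pi_m$ define $$N^{(m)}(j_1,\ldots,j_m):=\prod_{k=1}^{m-1}\left[z_m^{m-k}-\sigma\big([m]\setminus\{j_1,\ldots,j_{k-1}\},j_k\big)+1\right]$$ (where for $k=1$ the set $[m]\setminus\{j_1,\ldots,j_{k-1}\}$ is $[m]$). Then the voting situation $\mathcal{N}^{(m)}_{\boldsymbol{\sigma},\bar\theta_m}:=\{N^{(m)}(j_1,\ldots,j_m):(j_1,\ldots,j_m)\in\Pi_m\}$ is $q$-concordant with $\boldsymbol{\sigma}$ and its total number of voters is $n(\mathcal{N}^{(m)}_{\boldsymbol{\sigma},\bar\theta_m})=\bar\theta_m$.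
   Context: Let $[k]=\{1,\dots,k\}$ (with $[0]=\emptyset$), $[m]$ the set of candidates, and $\Pi_m$ the set of permutations $(j_1,\ldots,j_m)$ of the elements of $[m]$. Ranking functions and patterns. For $A\subseteq[m]$, a map $\sigma(A,\cdot):A\to\{1,\ldots,|A|\}$ is a ranking function if for each $i\in A$, $\sigma(A,i)=1+\left|\{j\in A:\sigma(A,j)\le\sigma(A,i)-1\}\right|$. It is strict if it is injective (hence a bijection onto $\{1,\ldots,|A|\}$), and weak otherwise. A ranking pattern over $[m]$ is a family $\boldsymbol{\sigma}=\{\sigma(A,\cdot):A\subseteq[m],\,|A|\ge2\}$ of ranking functions; it is strict if it contains no weak ranking function. $\hat\Sigma^{(m)}$ denotes the set of all strict ranking patterns over $[m]$. Voting situations. A voting situation is a family $\mathcal{N}^{(m)}=\{N^{(m)}(j_1,\ldots,j_m):(j_1,\ldots,j_m)\in\Pi_m\}$ of non-negative integers, where $N^{(m)}(j_1,\ldots,j_m)$ is the number of voters (in a finite nonempty set of voters) whose preference ranking, from most to least preferred, is $(j_1,\ldots,j_m)$. The total number of voters is $n(\mathcal{N}^{(m)})=\sum_{(j_1,\ldots,j_m)\in\Pi_m}N^{(m)}(j_1,\ldots,j_m)$. For $A\subseteq[m]$ and $i\in A$, $n_i(A)$ is the number of votes obtained by $i$ when $A$ is the set of competing candidates, i.e. the sum of $N^{(m)}(j_1,\ldots,j_m)$ over all $(j_1,\ldots,j_m)\in\Pi_m$ in which $i$ occupies an earlier position than every other element of $A$. Concordance. $\boldsymbol{\sigma}$ and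 $\mathcal{N}^{(m)}$ are $q$-concordant if for any $A\subseteq[m]$ and $i,j\in A$ with $i\ne j$: $\sigma(A,i)<\sigma(A,j)\Leftrightarrow n_i(A)>n_j(A)$, and $\sigma(A,i)=\sigma(A,j)\Leftrightarrow n_i(A)=n_j(A)$. *)

theory Defs
  imports Complex_Main "HOL-Combinatorics.Multiset_Permutations"
begin

definition ranking_function :: "nat set \<Rightarrow> (nat \<Rightarrow> nat) \<Rightarrow> bool" where
  "ranking_function A r \<longleftrightarrow>
     (\<forall>i\<in>A. r i \<in> {1..card A}) \<and> (\<forall>i\<in>A. r i = 1 + card {j \<in> A. r j \<le> r i - 1})"

definition strict_ranking_function :: "nat set \<Rightarrow> (nat \<Rightarrow> nat) \<Rightarrow> bool" where
  "strict_ranking_function A r \<longleftrightarrow> ranking_function A r \<and> inj_on r A"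

text \<open>A pattern is a total function of the set and the candidate. Only its values at
  \<open>i \<in> A\<close>, where \<open>A \<subseteq> {1..m}\<close> has at least two elements, are meaningful.\<close>

definition ranking_pattern :: "nat \<Rightarrow> (nat set \<Rightarrow> nat \<Rightarrow> nat) \<Rightarrow> bool" where
  "ranking_pattern m \<sigma> \<longleftrightarrow> (\<forall>A. A \<subseteq> {1..m} \<and> card A \<ge> 2 \<longrightarrow> ranking_function A (\<sigma> A))"

definition strict_ranking_patterns :: "nat \<Rightarrow> (nat set \<Rightarrow> nat \<Rightarrow> nat) set" where
  "strict_ranking_patterns m = {\<sigma>. ranking_pattern m \<sigma> \<and>
     (\<forall>A. A \<subseteq> {1..m} \<and> card A \<ge> 2 \<longrightarrow> strict_ranking_function A (\<sigma> A))}"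

text \<open>A preference ranking \<open>(j\<^sub>1, \<dots>, j\<^sub>m)\<close> is a list in \<^term>\<open>permutations_of_set {1..m}\<close>,
  most preferred candidate first, so that \<open>j\<^sub>k\<close> is \<open>js ! (k - 1)\<close>.\<close>

definition total_voters :: "nat \<Rightarrow> (nat list \<Rightarrow> int) \<Rightarrow> int" where
  "total_voters m N = (\<Sum>js\<in>permutations_of_set {1..m}. N js)"

text \<open>The second conjunct says that the set of voters is nonempty.\<close>

definition voting_situation :: "nat \<Rightarrow> (nat list \<Rightarrow> int) \<Rightarrow> bool" where
  "voting_situation m N \<longleftrightarrow>
     (\<forall>js\<in>permutations_of_set {1..m}. N js \<ge> 0) \<and> total_voters m N > 0"

definition precedes :: "nat list \<Rightarrow> nat \<Rightarrow> nat \<Rightarrow> bool" where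
  "precedes js i j \<longleftrightarrow> (\<exists>p q. p < q \<and> q < length js \<and> js ! p = i \<and> js ! q = j)"

definition votes :: "nat \<Rightarrow> (nat list \<Rightarrow> int) \<Rightarrow> nat set \<Rightarrow> nat \<Rightarrow> int" where
  "votes m N A i =
     (\<Sum>js\<in>{js \<in> permutations_of_set {1..m}. \<forall>j\<in>A - {i}. precedes js i j}. N js)"

definition q_concordant ::
    "nat \<Rightarrow> (nat set \<Rightarrow> nat \<Rightarrow> nat) \<Rightarrow> (nat list \<Rightarrow> int) \<Rightarrow> bool" where
  "q_concordant m \<sigma> N \<longleftrightarrow>
     (\<forall>A i j. A \<subseteq> {1..m} \<and> i \<in> A \<and> j \<in> A \<and> i \<noteq> j \<longrightarrow>
        (\<sigma> A i < \<sigma> A j \<longleftrightarrow> votes m N A i > votes m N A j) \<and>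
        (\<sigma> A i = \<sigma> A j \<longleftrightarrow> votes m N A i = votes m N A j))"

definition z_const :: "nat \<Rightarrow> int" where
  "z_const m = 17 * int m * fact m"

definition theta_bar :: "nat \<Rightarrow> int" where
  "theta_bar m =
     (\<Prod>h=2..m. int h * z_const m ^ (h - 1) - (int h * (int h - 1)) div 2)"

definition pattern_situation :: "nat \<Rightarrow> (nat set \<Rightarrow> nat \<Rightarrow> nat) \<Rightarrow> nat list \<Rightarrow> int" where
  "pattern_situation m \<sigma> js =
     (\<Prod>k=1..m - 1. z_const m ^ (m - k)
        - int (\<sigma> ({1..m} - set (take (k - 1) js)) (js ! (k - 1))) + 1)"

end

theory Submission
  imports Defs
begin

text \<open>
  Read a preference ranking as a sequential choice without replacement: if \<open>B\<close> is the set of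
  candidates not yet chosen and \<open>b = card B\<close>, then \<open>x \<in> B\<close> is chosen with weight
  \<open>w(B, x) = z ^ (b - 1) - \<sigma>(B, x) + 1\<close>, and \<open>N\<close> is the product of these weights. For a strict
  pattern the weights over \<open>B\<close> sum to \<open>S(b) = b * z ^ (b - 1) - b * (b - 1) / 2\<close>, whatever the
  pattern, so the total weight of the rankings of \<open>B\<close> is \<open>T(b) = S(2) * \<dots> * S(b)\<close>.

  Let \<open>D(B)\<close> be the difference between the votes of \<open>i\<close> and of \<open>j\<close> in the contest \<open>A\<close>, counted over
  the rankings of \<open>B \<supseteq> A\<close>, where \<open>\<sigma>(A, i) < \<sigma>(A, j)\<close>. Conditioning on the first choice gives
  \<open>D(B) = (\<sigma>(B, j) - \<sigma>(B, i)) * T(b - 1) + (\<Sum>l\<in>B - A. w(B, l) * D(B - {l}))\<close>.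
  As soon as \<open>z \<ge> m\<^sup>2\<close> one has \<open>w(B, l) \<ge> b * S(b - 1)\<close>, so that a single term of the last sum
  outweighs the first summand, and \<open>D(B) \<ge> T(b - 1) > 0\<close> follows by induction on \<open>b\<close>.
\<close>

section \<open>Sequential choice without replacement\<close>

fun list_weight :: "('a set \<Rightarrow> 'a \<Rightarrow> int) \<Rightarrow> 'a set \<Rightarrow> 'a list \<Rightarrow> int" where
  "list_weight w B [] = 1"
| "list_weight w B (x # xs) = w B x * list_weight w (B - {x}) xs"

text \<open>Links the recursion, suited to induction on the first choice, with the indexed product
  used by \<open>pattern_situation\<close>.\<close>

lemma list_weight_eq_prod:
  "list_weight w B xs = (\<Prod>k<length xs. w (B - set (take k xs)) (xs ! k))"
proof (induction xs arbitrary: B)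
  case (Cons x xs)
  have "(\<Prod>k<length (x # xs). w (B - set (take k (x # xs))) ((x # xs) ! k))
     = w B x * (\<Prod>k<length xs. w (B - insert x (set (take k xs))) (xs ! k))"
    by (simp add: prod.lessThan_Suc_shift del: prod.lessThan_Suc)
  also have "\<dots> = list_weight w B (x # xs)"
    by (simp add: Cons Diff_insert2[symmetric])
  finally show ?case by simp
qed simp

lemma sum_permutations_of_set_Cons:
  assumes "finite B" "B \<noteq> {}"
  shows "(\<Sum>xs\<in>permutations_of_set B. f xs)
    = (\<Sum>x\<in>B. \<Sum>ys\<in>permutations_of_set (B - {x}). f (x # ys))"
proof -
  have "(\<Sum>xs\<in>permutations_of_set B. f xs)
      = (\<Sum>x\<in>B. \<Sum>xs\<in>(#) x ` permutations_of_set (B - {x}). f xs)"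
    unfolding permutations_of_set_nonempty[OF assms(2)]
    by (rule sum.UNION_disjoint) (use assms in auto)
  also have "\<dots> = (\<Sum>x\<in>B. \<Sum>ys\<in>permutations_of_set (B - {x}). f (x # ys))"
    by (simp add: sum.reindex)
  finally show ?thesis .
qed

definition total_weight :: "('a set \<Rightarrow> 'a \<Rightarrow> int) \<Rightarrow> 'a set \<Rightarrow> int" where
  "total_weight w B = (\<Sum>xs\<in>permutations_of_set B. list_weight w B xs)"

lemma total_weight_rec:
  assumes "finite B" "B \<noteq> {}"
  shows "total_weight w B = (\<Sum>x\<in>B. w B x * total_weight w (B - {x}))"
  unfolding total_weight_def
  by (simp add: sum_permutations_of_set_Cons[OF assms] sum_distrib_left)

text \<open>Generalises \<open>votes\<close> from \<open>{1..m}\<close> to any set \<open>B\<close>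
  of remaining candidates, because the induction shrinks \<open>B\<close> while the contest
  \<open>A\<close> stays fixed.\<close>

definition first_in_weight ::
    "(nat set \<Rightarrow> nat \<Rightarrow> int) \<Rightarrow> nat set \<Rightarrow> nat set \<Rightarrow> nat \<Rightarrow> int" where
  "first_in_weight w B A i =
     (\<Sum>xs\<in>{xs \<in> permutations_of_set B. \<forall>j\<in>A - {i}. precedes xs i j}. list_weight w B xs)"

lemma precedes_Cons:
  "precedes (x # xs) i j \<longleftrightarrow> (x = i \<and> j \<in> set xs) \<or> precedes xs i j"
proof
  assume "precedes (x # xs) i j"
  then obtain p q where pq: "p < q" "q < length (x # xs)" "(x # xs) ! p = i" "(x # xs) ! q = j"
    unfolding precedes_def by blast
  obtain q' where q': "q = Suc q'" using pq(1) by (cases q) auto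
  show "(x = i \<and> j \<in> set xs) \<or> precedes xs i j"
  proof (cases p)
    case 0
    then show ?thesis using pq q' by auto
  next
    case (Suc p')
    then have "p' < q'" "q' < length xs" "xs ! p' = i" "xs ! q' = j" using pq q' by auto
    then show ?thesis unfolding precedes_def by blast
  qed
next
  assume "(x = i \<and> j \<in> set xs) \<or> precedes xs i j"
  then show "precedes (x # xs) i j"
  proof
    assume "x = i \<and> j \<in> set xs"
    then obtain q where "q < length xs" "xs ! q = j" "x = i" by (auto simp: in_set_conv_nth)
    then show ?thesis unfolding precedes_def by (intro exI[of _ 0] exI[of _ "Suc q"]) auto
  next
    assume "precedes xs i j"
    then obtain p q where "p < q" "q < length xs" "xs ! p = i" "xs ! q = j"
      unfolding precedes_def by blast
    then show ?thesis
      unfolding precedes_def by (intro exI[of _ "Suc p"] exI[of _ "Suc q"]) auto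
  qed
qed

lemma precedes_in_set: "precedes xs i j \<Longrightarrow> i \<in> set xs \<and> j \<in> set xs"
  unfolding precedes_def by force

text \<open>Split by the first choice. If it is \<open>i\<close>, then \<open>i\<close> wins
  \<open>A\<close> under every continuation; if it is another member of \<open>A\<close>, then
  \<open>i\<close> has lost; if it lies outside \<open>A\<close>, the contest is still open among
  the remaining candidates.\<close>

lemma first_in_weight_rec:
  assumes "finite B" "A \<subseteq> B" "i \<in> A"
  shows "first_in_weight w B A i = w B i * total_weight w (B - {i})
    + (\<Sum>l\<in>B - A. w B l * first_in_weight w (B - {l}) A i)"
proof -
  define P where "P xs \<longleftrightarrow> (\<forall>j\<in>A - {i}. precedes xs i j)" for xs
  define g where
    "g x = (\<Sum>ys\<in>permutations_of_set (B - {x}). if P (x # ys) then list_weight w B (x # ys) else 0)"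
    for x
  \<comment> \<open>A conditional summand lets the sum run over all permutations, so that it can be
    split by the first entry.\<close>
  have fw: "first_in_weight w C A i
      = (\<Sum>xs\<in>permutations_of_set C. if P xs then list_weight w C xs else 0)"
    if "finite C" for C
    unfolding first_in_weight_def P_def[symmetric] by (simp add: sum.inter_filter)
  have "first_in_weight w B A i = (\<Sum>x\<in>B. g x)"
    unfolding fw[OF assms(1)] g_def
    by (rule sum_permutations_of_set_Cons) (use assms in auto)
  also have "\<dots> = (\<Sum>x\<in>A. g x) + (\<Sum>l\<in>B - A. g l)"
    using assms by (simp add: sum.subset_diff add.commute)
  also have "(\<Sum>x\<in>A. g x) = g i + (\<Sum>x\<in>A - {i}. g x)"
    using assms finite_subset by (intro sum.remove) auto
  also have "(\<Sum>x\<in>A - {i}. g x) = 0"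
  proof (intro sum.neutral ballI)
    fix x assume x: "x \<in> A - {i}"
    \<comment> \<open>The rival \<open>x\<close> does not recur in \<open>ys\<close>, so
      \<open>i\<close> cannot precede it.\<close>
    have "\<not> P (x # ys)" if "ys \<in> permutations_of_set (B - {x})" for ys
      using x permutations_of_setD(1)[OF that] precedes_in_set[of ys i x]
      by (auto simp: P_def precedes_Cons)
    then show "g x = 0" unfolding g_def by (intro sum.neutral) auto
  qed
  also have "g i = w B i * total_weight w (B - {i})"
  proof -
    have "P (i # ys)" if "ys \<in> permutations_of_set (B - {i})" for ys
      using permutations_of_setD(1)[OF that] assms by (auto simp: P_def precedes_Cons)
    then show ?thesis unfolding g_def total_weight_def by (simp add: sum_distrib_left)
  qed
  also have "(\<Sum>l\<in>B - A. g l) = (\<Sum>l\<in>B - A. w B l * first_in_weight w (B - {l}) A i)"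
  proof (intro sum.cong refl)
    fix l assume "l \<in> B - A"
    then have "P (l # ys) \<longleftrightarrow> P ys" for ys
      using assms by (auto simp: P_def precedes_Cons)
    then show "g l = w B l * first_in_weight w (B - {l}) A i"
      unfolding g_def using assms(1)
      by (auto simp: fw sum_distrib_left intro!: sum.cong)
  qed
  finally show ?thesis by simp
qed

section \<open>Weights attached to a strict ranking pattern\<close>

text \<open>The last choice is forced and contributes no factor, hence the value \<open>1\<close> on singletons.\<close>

definition stage_weight :: "int \<Rightarrow> (nat set \<Rightarrow> nat \<Rightarrow> nat) \<Rightarrow> nat set \<Rightarrow> nat \<Rightarrow> int" where
  "stage_weight z \<sigma> B x = (if card B \<ge> 2 then z ^ (card B - 1) - int (\<sigma> B x) + 1 else 1)"

definition stage_total :: "int \<Rightarrow> nat \<Rightarrow> int" where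
  "stage_total z h = int h * z ^ (h - 1) - (int h * (int h - 1)) div 2"

definition ranking_total :: "int \<Rightarrow> nat \<Rightarrow> int" where
  "ranking_total z b = (\<Prod>h=2..b. stage_total z h)"

lemma ranking_total_0 [simp]: "ranking_total z 0 = 1"
  by (simp add: ranking_total_def)

text \<open>The product starts at \<open>h = 2\<close>, but \<open>b = 0\<close> is covered as well
  since \<open>stage_total z 1 = 1\<close>.\<close>

lemma ranking_total_Suc:
  "ranking_total z (Suc b) = stage_total z (Suc b) * ranking_total z b"
  by (cases b) (simp_all add: ranking_total_def stage_total_def prod.nat_ivl_Suc')

lemma strict_ranking_function_bij:
  assumes "finite B" "strict_ranking_function B r"
  shows "bij_betw r B {1..card B}"
proof -
  have "inj_on r B" "r ` B \<subseteq> {1..card B}"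
    using assms(2) by (auto simp: strict_ranking_function_def ranking_function_def)
  then show ?thesis
    by (simp add: bij_betw_def card_image card_subset_eq)
qed

lemma strict_ranking_patternsD:
  assumes "\<sigma> \<in> strict_ranking_patterns m" "B \<subseteq> {1..m}" "card B \<ge> 2"
  shows "bij_betw (\<sigma> B) B {1..card B}"
proof (rule strict_ranking_function_bij)
  show "finite B" using assms(2) finite_subset by blast
  show "strict_ranking_function B (\<sigma> B)"
    using assms by (simp add: strict_ranking_patterns_def)
qed

text \<open>The ranks in a strict ranking of \<open>B\<close> are \<open>1, ..., card B\<close>,
  each taken once, so their sum does not depend on the pattern.\<close>

lemma sum_stage_weight:
  assumes "\<sigma> \<in> strict_ranking_patterns m" "B \<subseteq> {1..m}" "B \<noteq> {}"
  shows "(\<Sum>x\<in>B. stage_weight z \<sigma> B x) = stage_total z (card B)"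
proof -
  have "finite B" using assms(2) finite_subset by blast
  then have "card B \<noteq> 0" using assms(3) by simp
  then consider "card B = 1" | "card B \<ge> 2" by linarith
  then show ?thesis
  proof cases
    case 1
    then show ?thesis by (simp add: stage_weight_def stage_total_def)
  next
    case 2
    have ranks: "(\<Sum>x\<in>B. int (\<sigma> B x)) = (\<Sum>k\<in>{1..card B}. int k)"
      by (rule sum.reindex_bij_betw[OF strict_ranking_patternsD[OF assms(1,2) 2]])
    \<comment> \<open>The doubled form shows that \<open>n * (n - 1)\<close> is even, so the
      \<open>div 2\<close> is exact.\<close>
    have "2 * (\<Sum>k\<in>{1..n}. int k) = int n * (int n - 1) + 2 * int n" for n
      by (induction n) (simp_all add: algebra_simps)
    from this[of "card B"]
    have "(\<Sum>k\<in>{1..card B}. int k) = (int (card B) * (int (card B) - 1)) div 2 + int (card B)"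
      by linarith
    then show ?thesis
      using 2 ranks by (simp add: stage_weight_def stage_total_def sum.distrib sum_subtractf)
  qed
qed

text \<open>By induction the total after the first choice depends only on the number of candidates
  left, hence it factors out of the sum over that choice.\<close>

lemma total_weight_stage_weight:
  assumes "\<sigma> \<in> strict_ranking_patterns m" "B \<subseteq> {1..m}"
  shows "total_weight (stage_weight z \<sigma>) B = ranking_total z (card B)"
  using assms(2)
proof (induction "card B" arbitrary: B)
  case 0
  then have "B = {}" using finite_subset[of B "{1..m}"] by simp
  then show ?case by (simp add: total_weight_def)
next
  case (Suc b)
  have B: "finite B" "B \<noteq> {}" using Suc.hyps(2) by (auto intro: card_ge_0_finite)
  have "total_weight (stage_weight z \<sigma>) (B - {x}) = ranking_total z b" if "x \<in> B" for x
  proof -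
    have "b = card (B - {x})" using Suc.hyps(2) B that by simp
    then show ?thesis using Suc.hyps(1)[of "B - {x}"] Suc.prems by blast
  qed
  then have "total_weight (stage_weight z \<sigma>) B
      = (\<Sum>x\<in>B. stage_weight z \<sigma> B x) * ranking_total z b"
    by (simp add: total_weight_rec[OF B] sum_distrib_right)
  then show ?case
    using ranking_total_Suc[of z b] Suc.hyps(2)
    by (simp add: sum_stage_weight[OF assms(1) Suc.prems B(2)])
qed

lemma pattern_situation_eq_list_weight:
  assumes "m \<ge> 1" "js \<in> permutations_of_set {1..m}"
  shows "pattern_situation m \<sigma> js = list_weight (stage_weight (z_const m) \<sigma>) {1..m} js"
proof -
  let ?w = "stage_weight (z_const m) \<sigma>"
  define f where "f k = ?w ({1..m} - set (take k js)) (js ! k)" for k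
  have js: "set js = {1..m}" "distinct js" using assms(2) permutations_of_setD by blast+
  then have len: "length js = m" using distinct_card by fastforce
  have card: "card ({1..m} - set (take k js)) = m - k" if "k \<le> m" for k
  proof -
    have "set (take k js) \<subseteq> {1..m}" using js(1) set_take_subset by metis
    then show ?thesis using that js(2) len by (simp add: card_Diff_subset distinct_card)
  qed
  have "list_weight ?w {1..m} js = (\<Prod>k<m. f k)"
    by (simp add: list_weight_eq_prod len f_def)
  also have "\<dots> = (\<Prod>k<m - 1. f k)"
  proof -
    \<comment> \<open>The last factor belongs to a singleton; this reconciles the \<open>m\<close>
      factors here with the \<open>m - 1\<close> of \<open>pattern_situation\<close>.\<close>
    have "f (m - 1) = 1" using assms(1) card[of "m - 1"] by (simp add: f_def stage_weight_def)
    then show ?thesis using assms(1) prod.lessThan_Suc[of f "m - 1"] by simp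
  qed
  also have "\<dots> = (\<Prod>k=1..m - 1. f (k - 1))"
    using prod.atLeast1_atMost_eq[of "\<lambda>k. f (k - 1)" "m - 1"] by simp
  also have "\<dots> = pattern_situation m \<sigma> js"
    unfolding pattern_situation_def
  proof (intro prod.cong refl)
    fix k assume "k \<in> {1..m - 1}"
    then have "card ({1..m} - set (take (k - 1) js)) = Suc (m - k)" "m - k \<ge> 1"
      using card[of "k - 1"] by auto
    then show "f (k - 1) = z_const m ^ (m - k)
        - int (\<sigma> ({1..m} - set (take (k - 1) js)) (js ! (k - 1))) + 1"
      by (simp add: f_def stage_weight_def)
  qed
  finally show ?thesis by simp
qed

section \<open>Positivity and domination\<close>

lemma stage_total_pos:
  assumes "h \<ge> 1" "z \<ge> int h"
  shows "stage_total z h > 0"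
proof (cases "h = 1")
  case True
  then show ?thesis by (simp add: stage_total_def)
next
  case False
  have "z ^ 1 \<le> z ^ (h - 1)" by (rule power_increasing) (use assms False in auto)
  then have "int h * int h \<le> int h * z ^ (h - 1)" using assms by (intro mult_left_mono) auto
  moreover have "int h * (int h - 1) = int h * int h - int h" by (simp add: algebra_simps)
  moreover have "int h * (int h - 1) \<ge> 0" using assms by simp
  ultimately show ?thesis unfolding stage_total_def using assms by linarith
qed

lemma ranking_total_pos:
  assumes "z \<ge> int b"
  shows "ranking_total z b > 0"
  unfolding ranking_total_def using assms by (intro prod_pos) (auto intro!: stage_total_pos)

lemma stage_weight_pos:
  assumes "\<sigma> \<in> strict_ranking_patterns m" "B \<subseteq> {1..m}" "x \<in> B" "z \<ge> int m"
  shows "stage_weight z \<sigma> B x > 0"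
proof (cases "card B \<ge> 2")
  case True
  have "\<sigma> B x \<le> card B"
    using bij_betwE[OF strict_ranking_patternsD[OF assms(1,2) True]] assms(3) by auto
  moreover have "card B \<le> m" using card_mono[OF _ assms(2)] by simp
  moreover have "z ^ 1 \<le> z ^ (card B - 1)"
    using True assms(4) \<open>card B \<le> m\<close> by (intro power_increasing) auto
  ultimately show ?thesis using True assms(4) by (simp add: stage_weight_def)
qed (simp add: stage_weight_def)

lemma list_weight_stage_weight_nonneg:
  assumes "\<sigma> \<in> strict_ranking_patterns m" "B \<subseteq> {1..m}" "z \<ge> int m"
    and "distinct xs" "set xs \<subseteq> B"
  shows "list_weight (stage_weight z \<sigma>) B xs \<ge> 0"
  using assms(2,4,5)
proof (induction xs arbitrary: B)
  case (Cons x xs)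
  have "stage_weight z \<sigma> B x > 0"
    using stage_weight_pos[OF assms(1) Cons.prems(1) _ assms(3)] Cons.prems(3) by simp
  moreover have "list_weight (stage_weight z \<sigma>) (B - {x}) xs \<ge> 0"
    by (rule Cons.IH) (use Cons.prems in auto)
  ultimately show ?case by simp
qed simp

text \<open>With \<open>p = z ^ (b - 1)\<close>, the right-hand side is at most
  \<open>(b + 1) * b * p\<close>. Writing \<open>b\<close> as \<open>(b + 1) - 1\<close> gives a
  main term at most \<open>z * p = z ^ b\<close>, while the subtracted \<open>(b + 1) * p\<close> is
  at least \<open>b + 1\<close> and so covers the rank of \<open>x\<close>.\<close>

lemma stage_weight_ge:
  assumes "\<sigma> \<in> strict_ranking_patterns m" "B \<subseteq> {1..m}" "x \<in> B" "card B = Suc b" "b \<ge> 1"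
    and "z \<ge> int m * int m"
  shows "stage_weight z \<sigma> B x \<ge> int (Suc b) * stage_total z b"
proof -
  define p where "p = z ^ (b - 1)"
  have bm: "Suc b \<le> m" using card_mono[OF _ assms(2)] assms(4) by simp
  have \<sigma>x: "\<sigma> B x \<le> Suc b"
    using bij_betwE[OF strict_ranking_patternsD[OF assms(1,2)]] assms(3-5) by auto
  have "int (Suc b) * int (Suc b) \<le> int m * int m"
    by (intro mult_mono) (use bm in auto)
  then have z: "int (Suc b) * int (Suc b) \<le> z" using assms(6) by simp
  moreover have "int (Suc b) * int (Suc b) > 0" by simp
  ultimately have p: "p \<ge> 1" unfolding p_def by (intro one_le_power) linarith
  have "stage_total z b \<le> int b * p"
    using assms(5) by (simp add: stage_total_def p_def pos_imp_zdiv_nonneg_iff)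
  then have "int (Suc b) * stage_total z b \<le> int (Suc b) * (int b * p)"
    by (intro mult_left_mono) auto
  also have "\<dots> = int (Suc b) * int (Suc b) * p - int (Suc b) * p"
    by (simp add: algebra_simps)
  also have "\<dots> \<le> z * p - int (Suc b) * 1"
    by (intro diff_mono mult_right_mono mult_left_mono) (use z p in auto)
  also have "z * p = z ^ b" using assms(5) by (simp add: p_def power_eq_if)
  finally show ?thesis using \<sigma>x assms(4,5) by (simp add: stage_weight_def)
qed

text \<open>The quantitative bound, rather than mere positivity, is what carries the induction: a
  later lead of \<open>i\<close> over \<open>j\<close> must make up for a first choice from
  \<open>B\<close> that may favour \<open>j\<close>.\<close>

lemma first_in_weight_diff_ge:
  assumes \<sigma>: "\<sigma> \<in> strict_ranking_patterns m" and z: "z \<ge> int m * int m"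
    and "B \<subseteq> {1..m}" "A \<subseteq> B" "i \<in> A" "j \<in> A" "\<sigma> A i < \<sigma> A j"
  shows "first_in_weight (stage_weight z \<sigma>) B A i - first_in_weight (stage_weight z \<sigma>) B A j
    \<ge> ranking_total z (card B - 1)"
  using assms(3,4)
proof (induction "card B" arbitrary: B rule: less_induct)
  case less
  let ?w = "stage_weight z \<sigma>"
  define D where "D C = first_in_weight ?w C A i - first_in_weight ?w C A j" for C
  define T where "T = ranking_total z (card B - 1)"
  have finB: "finite B" using less.prems(1) finite_subset by blast
  have ij: "i \<in> B" "j \<in> B" "i \<noteq> j" using less.prems assms(5-7) by auto
  then have "card {i, j} \<le> card B" using finB by (intro card_mono) auto
  then have cB: "card B \<ge> 2" using ij by simp
  have cBm: "card B \<le> m" using card_mono[OF _ less.prems(1)] by simp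
  have "int m * 1 \<le> int m * int m" by (intro mult_left_mono) (use cB cBm in auto)
  then have zm: "z \<ge> int m" using z by simp
  have Tpos: "T > 0" unfolding T_def using cBm zm by (intro ranking_total_pos) simp
  have tot: "total_weight ?w (B - {x}) = T" if "x \<in> B" for x
    using total_weight_stage_weight[OF \<sigma>, of "B - {x}"] that less.prems(1) finB
    by (auto simp: T_def)
  have w: "?w B j = ?w B i + int (\<sigma> B i) - int (\<sigma> B j)" using cB by (simp add: stage_weight_def)
  \<comment> \<open>The weights of \<open>i\<close> and \<open>j\<close> differ only by their ranks,
    and both are followed by the same total \<open>T\<close>.\<close>
  have D: "D B = (int (\<sigma> B j) - int (\<sigma> B i)) * T + (\<Sum>l\<in>B - A. ?w B l * D (B - {l}))"
    using first_in_weight_rec[OF finB less.prems(2) assms(5), of ?w]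
      first_in_weight_rec[OF finB less.prems(2) assms(6), of ?w]
    by (simp add: D_def tot ij w algebra_simps sum_subtractf)
  have "D B \<ge> T"
  proof (cases "A = B")
    case True
    have "1 * T \<le> (int (\<sigma> B j) - int (\<sigma> B i)) * T"
      by (intro mult_right_mono) (use assms(7) True Tpos in auto)
    then show ?thesis using D True by simp
  next
    case False
    then obtain l where l: "l \<in> B - A" using less.prems(2) by blast
    \<comment> \<open>Removing \<open>l\<close> leaves \<open>b + 1\<close> candidates, so the
      induction hypothesis gives the bound \<open>ranking_total z b\<close>.\<close>
    define b where "b = card B - 2"
    have b: "card B = Suc (Suc b)" using cB by (simp add: b_def)
    have IH: "D (B - {l}) \<ge> ranking_total z b" if "l \<in> B - A" for l
      using less.hyps[of "B - {l}"] less.prems that finB b by (auto simp: D_def)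
    have Tb: "ranking_total z b > 0" using cBm zm b by (intro ranking_total_pos) simp
    have wpos: "?w B l > 0" if "l \<in> B" for l
      using stage_weight_pos[OF \<sigma> less.prems(1) that zm] .
    have "int (card B) * T = int (Suc (Suc b)) * stage_total z (Suc b) * ranking_total z b"
      by (simp add: T_def b ranking_total_Suc)
    also have "\<dots> \<le> ?w B l * ranking_total z b"
      using stage_weight_ge[OF \<sigma> less.prems(1) _ b _ z, of l] l Tb
      by (intro mult_right_mono) auto
    also have "\<dots> \<le> ?w B l * D (B - {l})"
      using IH[OF l] wpos[of l] l by (intro mult_left_mono) auto
    also have "\<dots> \<le> (\<Sum>l\<in>B - A. ?w B l * D (B - {l}))"
    proof (rule member_le_sum[OF l])
      fix x assume "x \<in> B - A - {l}"
      then show "0 \<le> ?w B x * D (B - {x})"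
        using wpos[of x] IH[of x] Tb by (intro mult_nonneg_nonneg) auto
    qed (use finB in simp)
    finally have 1: "int (card B) * T \<le> (\<Sum>l\<in>B - A. ?w B l * D (B - {l}))" .
    \<comment> \<open>At worst \<open>i\<close> is last and \<open>j\<close> first in
      \<open>B\<close>, a loss of \<open>(card B - 1) * T\<close>; the gain of
      \<open>card B * T\<close> still leaves \<open>T\<close>.\<close>
    have "\<sigma> B i \<le> card B" "\<sigma> B j \<ge> 1"
      using bij_betwE[OF strict_ranking_patternsD[OF \<sigma> less.prems(1) cB]] ij by auto
    then have "(1 - int (card B)) * T \<le> (int (\<sigma> B j) - int (\<sigma> B i)) * T"
      using Tpos by (intro mult_right_mono) auto
    then show ?thesis using D 1 by (simp add: algebra_simps)
  qed
  then show ?case by (simp add: D_def T_def)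
qed

section \<open>Concordance and the number of voters\<close>

theorem theorem5:
  fixes m :: nat and \<sigma> :: "nat set \<Rightarrow> nat \<Rightarrow> nat"
  assumes "m \<ge> 2"
    and "\<sigma> \<in> strict_ranking_patterns m"
  shows "voting_situation m (pattern_situation m \<sigma>)
    \<and> q_concordant m \<sigma> (pattern_situation m \<sigma>)
    \<and> total_voters m (pattern_situation m \<sigma>) = theta_bar m"
proof -
  let ?z = "z_const m"
  let ?w = "stage_weight ?z \<sigma>"
  have N: "pattern_situation m \<sigma> js = list_weight ?w {1..m} js"
    if "js \<in> permutations_of_set {1..m}" for js
    using pattern_situation_eq_list_weight[OF _ that] assms(1) by simp
  \<comment> \<open>From \<open>m! >= m\<close> follows \<open>z >= m * m\<close>, the size that the
    domination argument requires.\<close>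
  have "int m \<le> fact m" using fact_ge_self[of m] by (metis of_nat_fact of_nat_le_iff)
  then have "17 * int m * fact m \<ge> 1 * int m * int m" by (intro mult_mono) auto
  then have z: "?z \<ge> int m * int m" by (simp add: z_const_def)
  have "int m * 1 \<le> int m * int m" by (intro mult_left_mono) (use assms(1) in auto)
  then have zm: "?z \<ge> int m" using z by simp
  have total: "total_voters m (pattern_situation m \<sigma>) = ranking_total ?z m"
    using total_weight_stage_weight[OF assms(2), of "{1..m}" ?z]
    by (simp add: total_voters_def total_weight_def N)
  have theta: "theta_bar m = ranking_total ?z m"
    by (simp add: theta_bar_def ranking_total_def stage_total_def)
  have nonneg: "pattern_situation m \<sigma> js \<ge> 0" if "js \<in> permutations_of_set {1..m}" for js
    using list_weight_stage_weight_nonneg[OF assms(2) order_refl zm] permutations_of_setD[OF that]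
    by (simp add: N[OF that])
  have votes: "votes m (pattern_situation m \<sigma>) A i = first_in_weight ?w {1..m} A i" for A i
    unfolding votes_def first_in_weight_def by (intro sum.cong) (auto simp: N)
  have less: "votes m (pattern_situation m \<sigma>) A j < votes m (pattern_situation m \<sigma>) A i"
    if "A \<subseteq> {1..m}" "i \<in> A" "j \<in> A" "\<sigma> A i < \<sigma> A j" for A i j
    using first_in_weight_diff_ge[OF assms(2) z order_refl that]
      ranking_total_pos[of "m - 1" ?z] zm unfolding votes card_atLeastAtMost by force
  have "q_concordant m \<sigma> (pattern_situation m \<sigma>)"
    unfolding q_concordant_def
  proof (intro allI impI, elim conjE)
    fix A i j assume A: "A \<subseteq> {1..m}" "i \<in> A" "j \<in> A" "i \<noteq> j"
    have "card {i, j} \<le> card A"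
      using A finite_subset[OF A(1)] by (intro card_mono) auto
    then have "bij_betw (\<sigma> A) A {1..card A}"
      using A by (intro strict_ranking_patternsD[OF assms(2)]) auto
    \<comment> \<open>Strictness rules out ties in rank, so \<open>less\<close>, applied to
      \<open>i, j\<close> or to \<open>j, i\<close>, settles both equivalences.\<close>
    then have "\<sigma> A i \<noteq> \<sigma> A j" using A by (auto simp: bij_betw_def inj_on_def)
    then show "(\<sigma> A i < \<sigma> A j \<longleftrightarrow>
          votes m (pattern_situation m \<sigma>) A i > votes m (pattern_situation m \<sigma>) A j) \<and>
        (\<sigma> A i = \<sigma> A j \<longleftrightarrow>
          votes m (pattern_situation m \<sigma>) A i = votes m (pattern_situation m \<sigma>) A j)"
      using less[of A i j] less[of A j i] A by (cases "\<sigma> A i" "\<sigma> A j" rule: linorder_cases) auto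
  qed
  then show ?thesis
    using nonneg total theta ranking_total_pos[OF zm] by (simp add: voting_situation_def)
qed

end
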